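(* Let $\mathcal{X}\subseteq\{0,1\}^n$ be a non-empty downward closed set family, let $\mu$ be a distribution fully supported on $\mathcal{X}$, and let $\delta\in(0,1)$. If $$M_S \preceq I + (1-\delta)\,\mathrm{diag}(\mathbf{r}_S)^{-1}\quad\text{for each non-maximal } S\in\mathcal{X},$$ then the mixing time of the Glauber dynamics for $\mu$ satisfies $$T_{\mathrm{mix}}(P_{\mathrm{GD}}) = O\left((1+r_{\max})\frac{n}{\delta}\log\frac{1}{\mu_{\min}}\right),$$ where $\mu_{\min}=\min_{S\in\mathcal{X}}\mu(S)$.
   Context: Elements of $\{0,1\}^n$ are identified with subsets of $[n]$. $\mathcal{X}$ is downward closed if $T\in\mathcal{X}$ and $S\subseteq T$ imply $S\in\mathcal{X}$; $\mu$ is fully supported on $\mathcal{X}$ if $\mu(S)>0$ exactly for $S\in\mathcal{X}$. For $S\in\mathcal{X}$ let $V_S=\{i\in[n]\setminus S : S\cup\{i\}\in\mathcal{X}\}$; $S$ is maximal if $V_S=\emptyset$. Let $\mu^S$ be the distribution on $\{T\subseteq[n]\setminus S : S\cup T\in\mathcal{X}\}$ with $\mu^S(T)\propto\mu(S\cup T)$. For non-maximal $S$, $\mathbf{r}_S\in\mathbb{R}^{V_S}$ is given by $\mathbf{r}_S(i)=\mu(S\cup\{i\})/\mu(S)$, and $r_{\max}=\max_{S\in\mathcal{X}}\max_{i\in V_S}\mathbf{r}_S(i)$. The matrix $M_S\in\mathbb{R}^{V_S\times V_S}$ has $M_S(i,i)=0$ and, for $i\ne j$, $M_S(i,j)=\frac{\mu^S(\{i,j\})\mu^S(\emptyset)}{\mu^S(\{i\})\mu^S(\{j\})}-1$.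 $\preceq$ is the Loewner order. The Glauber dynamics for $\mu$ picks $i\in[n]$ uniformly at random, lets $S'=S_t\setminus\{i\}$; if $S'\cup\{i\}\notin\mathcal{X}$ sets $S_{t+1}=S'$, otherwise sets $S_{t+1}=S'\cup\{i\}$ with probability $\frac{\mu(S'\cup\{i\})}{\mu(S')+\mu(S'\cup\{i\})}$ and $S_{t+1}=S'$ otherwise. Mixing time: $T_{\mathrm{mix}}(P)=\max_{S}\min\{t: d_{\mathrm{TV}}(P^t(S,\cdot),\mu)\le 1/4\}$. *)

theory Defs
  imports "HOL-Probability.Probability"
begin

text \<open>The ground set \<open>[n]\<close> is \<open>{1..n}\<close>, and a set family \<open>X\<close> on it satisfies
  \<open>X \<subseteq> Pow {1..n}\<close>.\<close>

definition downward_closed :: "'a set set \<Rightarrow> bool" where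
  "downward_closed X \<longleftrightarrow> (\<forall>T\<in>X. \<forall>S. S \<subseteq> T \<longrightarrow> S \<in> X)"

definition fully_supported :: "'a pmf \<Rightarrow> 'a set \<Rightarrow> bool" where
  "fully_supported \<mu> X \<longleftrightarrow> (\<forall>S. pmf \<mu> S > 0 \<longleftrightarrow> S \<in> X)"

definition ext_set :: "nat \<Rightarrow> nat set set \<Rightarrow> nat set \<Rightarrow> nat set" where
  "ext_set n X S = {i \<in> {1..n} - S. insert i S \<in> X}"

definition maximal_in :: "nat \<Rightarrow> nat set set \<Rightarrow> nat set \<Rightarrow> bool" where
  "maximal_in n X S \<longleftrightarrow> ext_set n X S = {}"

definition link :: "nat \<Rightarrow> nat set set \<Rightarrow> nat set \<Rightarrow> nat set set" where
  "link n X S = {T. T \<subseteq> {1..n} - S \<and> S \<union> T \<in> X}"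

text \<open>The probability mass function of the conditional distribution \<open>\<mu>\<^sup>S\<close>.\<close>

definition cond_mass :: "nat \<Rightarrow> nat set set \<Rightarrow> nat set pmf \<Rightarrow> nat set \<Rightarrow> nat set \<Rightarrow> real" where
  "cond_mass n X \<mu> S T =
     (if T \<in> link n X S then pmf \<mu> (S \<union> T) / (\<Sum>U\<in>link n X S. pmf \<mu> (S \<union> U)) else 0)"

definition ratio :: "nat set pmf \<Rightarrow> nat set \<Rightarrow> nat \<Rightarrow> real" where
  "ratio \<mu> S i = pmf \<mu> (insert i S) / pmf \<mu> S"

text \<open>All ratios over \<open>ext_set\<close> are positive, so inserting \<open>0\<close> only matters when there is
  no ratio at all, i.e. for \<open>X = {{}}\<close>, where the maximum is taken to be \<open>0\<close>.\<close>

definition r_max :: "nat \<Rightarrow> nat set set \<Rightarrow> nat set pmf \<Rightarrow> real" where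
  "r_max n X \<mu> = Max (insert 0 (\<Union>S\<in>X. ratio \<mu> S ` ext_set n X S))"

definition mu_min :: "nat set set \<Rightarrow> nat set pmf \<Rightarrow> real" where
  "mu_min X \<mu> = Min (pmf \<mu> ` X)"

text \<open>A matrix in \<open>\<real>\<^bsup>V \<times> V\<^esup>\<close>, for a finite index set \<open>V\<close>, is a function of two arguments of
  which only the values on \<open>V\<close> matter.\<close>

definition psd_on :: "'i set \<Rightarrow> ('i \<Rightarrow> 'i \<Rightarrow> real) \<Rightarrow> bool" where
  "psd_on V A \<longleftrightarrow> (\<forall>i\<in>V. \<forall>j\<in>V. A i j = A j i) \<and>
     (\<forall>x :: 'i \<Rightarrow> real. 0 \<le> (\<Sum>i\<in>V. \<Sum>j\<in>V. x i * A i j * x j))"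

definition loewner_le :: "'i set \<Rightarrow> ('i \<Rightarrow> 'i \<Rightarrow> real) \<Rightarrow> ('i \<Rightarrow> 'i \<Rightarrow> real) \<Rightarrow> bool" where
  "loewner_le V A B \<longleftrightarrow> psd_on V (\<lambda>i j. B i j - A i j)"

definition diag_matrix :: "('i \<Rightarrow> real) \<Rightarrow> 'i \<Rightarrow> 'i \<Rightarrow> real" where
  "diag_matrix v i j = (if i = j then v i else 0)"

definition M_matrix :: "nat \<Rightarrow> nat set set \<Rightarrow> nat set pmf \<Rightarrow> nat set \<Rightarrow> nat \<Rightarrow> nat \<Rightarrow> real" where
  "M_matrix n X \<mu> S i j =
     (if i = j then 0
      else cond_mass n X \<mu> S {i, j} * cond_mass n X \<mu> S {} /
           (cond_mass n X \<mu> S {i} * cond_mass n X \<mu> S {j}) - 1)"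

definition glauber :: "nat \<Rightarrow> nat set set \<Rightarrow> nat set pmf \<Rightarrow> nat set \<Rightarrow> nat set pmf" where
  "glauber n X \<mu> S =
     bind_pmf (pmf_of_set {1..n}) (\<lambda>i.
       let S' = S - {i} in
       if insert i S' \<notin> X then return_pmf S'
       else map_pmf (\<lambda>b. if b then insert i S' else S')
              (bernoulli_pmf (pmf \<mu> (insert i S') / (pmf \<mu> S' + pmf \<mu> (insert i S')))))"

primrec kernel_power :: "('s \<Rightarrow> 's pmf) \<Rightarrow> nat \<Rightarrow> 's \<Rightarrow> 's pmf" where
  "kernel_power K 0 x = return_pmf x"
| "kernel_power K (Suc t) x = bind_pmf (kernel_power K t x) K"

definition tv_dist :: "'s pmf \<Rightarrow> 's pmf \<Rightarrow> real" where
  "tv_dist p q = (SUP A. \<bar>measure_pmf.prob p A - measure_pmf.prob q A\<bar>)"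

text \<open>Starting states range over the state space \<open>X\<close>. In \<open>enat\<close> the infimum of the empty set
  is \<open>\<infinity>\<close>, so a finite mixing time entails that the chain does get within distance \<open>1/4\<close> of
  \<open>\<mu>\<close> from every starting state.\<close>

definition mixing_time :: "'s set \<Rightarrow> ('s \<Rightarrow> 's pmf) \<Rightarrow> 's pmf \<Rightarrow> enat" where
  "mixing_time X K \<mu> =
     (SUP x\<in>X. INF t\<in>{t. tv_dist (kernel_power K t x) \<mu> \<le> 1 / 4}. enat t)"

end

theory Submission
  imports Defs
begin

text \<open>Bochner's method. Let \<open>L\<close> be the generator of the reversible chain that deletes each element at
  rate \<open>1\<close> and inserts \<open>i\<close> into \<open>S\<close> at rate \<open>r\<^sub>S(i)\<close>, and let \<open>E\<close> be its Dirichlet form. Expanding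
  \<open>\<parallel>Lf\<parallel>\<^sup>2\<close> and grouping by the smaller set \<open>S\<close> leaves \<open>E(f, f)\<close>, a sum of squares of second
  differences, and the quadratic forms \<open>x\<^sup>T(I - M\<^sub>S)x\<close> at \<open>x(i) = r\<^sub>S(i) (f(S + i) - f(S))\<close>. The
  hypothesis bounds these below by \<open>-(1 - \<delta>) E(f, f)\<close> in total, so \<open>\<parallel>Lf\<parallel>\<^sup>2 \<ge> \<delta> E(f, f)\<close>, which is a
  Poincare inequality. Glauber dynamics averages \<open>n\<close> orthogonal projections whose combined
  Dirichlet form is at least \<open>E / (n (1 + r\<^sub>m\<^sub>a\<^sub>x))\<close>; hence the variance contracts at each step.\<close>

locale weighted_complex =
  fixes n :: nat and X :: "nat set set" and \<mu> :: "nat set pmf"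
  assumes X_subset: "X \<subseteq> Pow {1..n}"
    and X_nonempty: "X \<noteq> {}"
    and X_down: "downward_closed X"
    and X_supp: "fully_supported \<mu> X"
begin

abbreviation m :: "nat set \<Rightarrow> real" where "m \<equiv> pmf \<mu>"
abbreviation V :: "nat set \<Rightarrow> nat set" where "V \<equiv> ext_set n X"

section \<open>Inner product, Dirichlet form and generator on functions of sets\<close>

definition diff :: "nat \<Rightarrow> (nat set \<Rightarrow> real) \<Rightarrow> nat set \<Rightarrow> real" where
  "diff i f S = f (insert i S) - f S"

definition ip :: "(nat set \<Rightarrow> real) \<Rightarrow> (nat set \<Rightarrow> real) \<Rightarrow> real" where
  "ip f g = (\<Sum>S\<in>X. m S * f S * g S)"

text \<open>The weight \<open>m (insert i S)\<close> is the stationary flow across the edge between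
  \<open>S\<close> and \<open>insert i S\<close>: deletion has rate \<open>1\<close>, and by
  \<open>m_ratio\<close> insertion carries the same flow, which is detailed balance.\<close>

definition energy :: "(nat set \<Rightarrow> real) \<Rightarrow> (nat set \<Rightarrow> real) \<Rightarrow> real" where
  "energy f g = (\<Sum>S\<in>X. \<Sum>i\<in>V S. m (insert i S) * diff i f S * diff i g S)"

definition up :: "(nat set \<Rightarrow> real) \<Rightarrow> nat set \<Rightarrow> real" where
  "up f S = (\<Sum>i\<in>V S. ratio \<mu> S i * diff i f S)"

definition down :: "(nat set \<Rightarrow> real) \<Rightarrow> nat set \<Rightarrow> real" where
  "down f S = (\<Sum>i\<in>S. diff i f (S - {i}))"

definition gen :: "(nat set \<Rightarrow> real) \<Rightarrow> nat set \<Rightarrow> real" where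
  "gen f S = up f S - down f S"

definition var :: "(nat set \<Rightarrow> real) \<Rightarrow> real" where
  "var f = ip f f - (ip (\<lambda>_. 1) f)\<^sup>2"

section \<open>Elementary facts about \<open>X\<close>, \<open>V\<close> and
  \<open>m\<close>\<close>

lemma finite_X: "finite X"
  using X_subset by (meson finite_Pow_iff finite_atLeastAtMost finite_subset)

lemma X_finite_mem: "S \<in> X \<Longrightarrow> finite S"
  using X_subset by (meson PowD finite_atLeastAtMost finite_subset subsetD)

lemma finite_V [simp]: "finite (V S)"
  by (simp add: ext_set_def)

lemma X_mem: "S \<in> X \<Longrightarrow> i \<in> S \<Longrightarrow> i \<in> {1..n}"
  using X_subset by blast

lemma V_mem: "i \<in> V S \<longleftrightarrow> i \<in> {1..n} \<and> i \<notin> S \<and> insert i S \<in> X"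
  by (auto simp: ext_set_def)

lemma V_memX: "insert i S \<in> X \<Longrightarrow> i \<notin> S \<Longrightarrow> i \<in> V S"
  using X_subset by (auto simp: V_mem)

lemma X_subD: "T \<in> X \<Longrightarrow> S \<subseteq> T \<Longrightarrow> S \<in> X"
  using X_down by (auto simp: downward_closed_def)

lemma empty_in_X: "{} \<in> X"
  using X_nonempty X_subD by blast

lemma m_pos: "S \<in> X \<Longrightarrow> m S > 0"
  using X_supp by (simp add: fully_supported_def)

lemma m_zero: "S \<notin> X \<Longrightarrow> m S = 0"
  using X_supp by (metis fully_supported_def pmf_nonneg order_le_less)

lemma set_pmf_eq_X: "set_pmf \<mu> = X"
  using m_pos m_zero by (force simp: set_pmf_iff)

lemma sum_m: "(\<Sum>S\<in>X. m S) = 1"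
  using finite_X set_pmf_eq_X by (intro sum_pmf_eq_1) auto

lemma m_ratio: "S \<in> X \<Longrightarrow> m S * ratio \<mu> S i = m (insert i S)"
  using m_pos[of S] by (simp add: ratio_def)

subsection \<open>The Bochner inequality\<close>

text \<open>Each edge is indexed by its upper end on the left and by its lower end on the
  right.\<close>

lemma sum_reindex_edges:
  fixes F :: "nat set \<Rightarrow> nat \<Rightarrow> real"
  shows "(\<Sum>S\<in>X. \<Sum>i\<in>S. F S i) = (\<Sum>S\<in>X. \<Sum>i\<in>V S. F (insert i S) i)"
proof -
  have "(\<Sum>S\<in>X. \<Sum>i\<in>S. F S i) = (\<Sum>(S,i)\<in>Sigma X (\<lambda>S. S). F S i)"
    using finite_X X_finite_mem by (intro sum.Sigma) auto
  also have "\<dots> = (\<Sum>(S,i)\<in>Sigma X V. F (insert i S) i)"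
    by (rule sum.reindex_bij_witness[of _ "\<lambda>(S,i). (insert i S, i)" "\<lambda>(S,i). (S - {i}, i)"])
       (auto simp: insert_absorb V_mem intro: X_subD dest: X_mem[simplified])
  also have "\<dots> = (\<Sum>S\<in>X. \<Sum>i\<in>V S. F (insert i S) i)"
    using finite_X by (intro sum.Sigma[symmetric]) auto
  finally show ?thesis .
qed

text \<open>Summation by parts: once \<open>down\<close> is moved to the lower end of each edge,
  both parts of \<open>gen g\<close> carry the same flow \<open>m (insert i S) * diff i g S\<close>,
  and the factor \<open>f S - f (insert i S)\<close> remains.\<close>

lemma ip_gen: "ip f (gen g) = - energy f g"
proof -
  have "(\<Sum>S\<in>X. m S * f S * up g S) = (\<Sum>S\<in>X. \<Sum>i\<in>V S. m (insert i S) * f S * diff i g S)"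
    by (intro sum.cong refl) (auto simp: up_def sum_distrib_left m_ratio[symmetric] intro!: sum.cong)
  moreover have "(\<Sum>S\<in>X. m S * f S * down g S) =
      (\<Sum>S\<in>X. \<Sum>i\<in>V S. m (insert i S) * f (insert i S) * diff i g S)"
  proof -
    have "(\<Sum>S\<in>X. m S * f S * down g S) = (\<Sum>S\<in>X. \<Sum>i\<in>S. m S * f S * diff i g (S - {i}))"
      by (simp add: down_def sum_distrib_left)
    also have "\<dots> = (\<Sum>S\<in>X. \<Sum>i\<in>V S. m (insert i S) * f (insert i S) * diff i g (insert i S - {i}))"
      by (rule sum_reindex_edges)
    also have "\<dots> = (\<Sum>S\<in>X. \<Sum>i\<in>V S. m (insert i S) * f (insert i S) * diff i g S)"
      by (intro sum.cong refl) (simp add: V_mem)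
    finally show ?thesis .
  qed
  ultimately show ?thesis
    by (simp add: ip_def gen_def energy_def diff_def[of _ f] right_diff_distrib left_diff_distrib
        sum_subtractf)
qed

lemma energy_sym: "energy f g = energy g f"
  by (simp add: energy_def mult_ac)

lemma energy_nonneg: "energy f f \<ge> 0"
  by (auto simp: energy_def mult.assoc intro!: sum_nonneg)

text \<open>An \<open>i\<close> in \<open>V S - {j}\<close> may fail to extend
  \<open>insert j S\<close>, but then its weight is zero. This lets both elements of a second-order
  term range over \<open>V S\<close>.\<close>

lemma sum_V_insert:
  assumes "S \<in> X" "j \<in> V S"
  shows "(\<Sum>i\<in>V (insert j S). m (insert i (insert j S)) * h i) =
         (\<Sum>i\<in>V S - {j}. m (insert i (insert j S)) * h i)"
proof (rule sum.mono_neutral_left)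
  show "V (insert j S) \<subseteq> V S - {j}"
    using assms by (auto simp: V_mem intro: X_subD)
  show "\<forall>i\<in>V S - {j} - V (insert j S). m (insert i (insert j S)) * h i = 0"
    using assms by (auto simp: V_mem m_zero)
qed simp

lemma ip_gen_up_down:
  "(\<Sum>S\<in>X. m S * (up f S * down f S)) =
   (\<Sum>S\<in>X. \<Sum>j\<in>V S. \<Sum>i\<in>V S - {j}. m (insert i (insert j S)) * (diff i f (insert j S) * diff j f S))"
proof -
  have "(\<Sum>S\<in>X. m S * (up f S * down f S)) =
      (\<Sum>S\<in>X. \<Sum>j\<in>S. m S * up f S * diff j f (S - {j}))"
    by (simp add: down_def sum_distrib_left mult_ac)
  also have "\<dots> = (\<Sum>S\<in>X. \<Sum>j\<in>V S. m (insert j S) * up f (insert j S) * diff j f (insert j S - {j}))"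
    by (rule sum_reindex_edges)
  also have "\<dots> = (\<Sum>S\<in>X. \<Sum>j\<in>V S. \<Sum>i\<in>V S - {j}.
      m (insert i (insert j S)) * (diff i f (insert j S) * diff j f S))"
  proof (intro sum.cong refl)
    fix S j assume S: "S \<in> X" and j: "j \<in> V S"
    then have jS: "insert j S \<in> X" "j \<notin> S" by (auto simp: V_mem)
    have "m (insert j S) * up f (insert j S) =
        (\<Sum>i\<in>V (insert j S). m (insert i (insert j S)) * diff i f (insert j S))"
      by (simp add: up_def sum_distrib_left m_ratio[OF jS(1), symmetric] mult_ac)
    also have "\<dots> = (\<Sum>i\<in>V S - {j}. m (insert i (insert j S)) * diff i f (insert j S))"
      by (rule sum_V_insert[OF S j])
    finally show "m (insert j S) * up f (insert j S) * diff j f (insert j S - {j}) =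
      (\<Sum>i\<in>V S - {j}. m (insert i (insert j S)) * (diff i f (insert j S) * diff j f S))"
      using jS by (simp add: sum_distrib_right mult.assoc)
  qed
  finally show ?thesis .
qed

text \<open>The diagonal of the squared sum is \<open>energy f f\<close>. An off-diagonal term
  removes two distinct elements from one set; reindexing twice expresses it at the set
  \<open>S\<close> that lacks both.\<close>

lemma ip_gen_down_down:
  "(\<Sum>S\<in>X. m S * (down f S * down f S)) = energy f f +
   (\<Sum>S\<in>X. \<Sum>j\<in>V S. \<Sum>i\<in>V S - {j}.
      m (insert i (insert j S)) * (diff i f (insert j S) * diff j f (insert i S)))"
proof -
  have "(\<Sum>S\<in>X. m S * (down f S * down f S)) =
      (\<Sum>S\<in>X. \<Sum>i\<in>S. m S * down f S * diff i f (S - {i}))"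
    by (simp add: down_def sum_distrib_left mult_ac)
  also have "\<dots> = (\<Sum>S\<in>X. \<Sum>i\<in>V S. m (insert i S) * down f (insert i S) * diff i f (insert i S - {i}))"
    by (rule sum_reindex_edges)
  also have "\<dots> = (\<Sum>S\<in>X. \<Sum>i\<in>V S. m (insert i S) * diff i f S * diff i f S +
      (\<Sum>j\<in>S. m (insert i S) * diff i f S * diff j f (insert i (S - {j}))))"
  proof (intro sum.cong refl)
    fix S i assume S: "S \<in> X" and i: "i \<in> V S"
    then have iS: "i \<notin> S" "finite S" by (auto simp: V_mem X_finite_mem)
    have "down f (insert i S) = diff i f S + (\<Sum>j\<in>S. diff j f (insert i S - {j}))"
      using iS by (simp add: down_def)
    also have "(\<Sum>j\<in>S. diff j f (insert i S - {j})) = (\<Sum>j\<in>S. diff j f (insert i (S - {j})))"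
      using iS by (intro sum.cong refl) (metis insert_Diff_if singletonD)
    finally show "m (insert i S) * down f (insert i S) * diff i f (insert i S - {i}) =
      m (insert i S) * diff i f S * diff i f S +
      (\<Sum>j\<in>S. m (insert i S) * diff i f S * diff j f (insert i (S - {j})))"
      using iS by (simp add: sum_distrib_left sum_distrib_right algebra_simps)
  qed
  also have "\<dots> = energy f f + (\<Sum>S\<in>X. \<Sum>i\<in>V S. \<Sum>j\<in>S.
      m (insert i S) * diff i f S * diff j f (insert i (S - {j})))"
    by (simp add: energy_def sum.distrib)
  \<comment> \<open>The sums are exchanged so that \<open>j\<close> in \<open>S\<close> becomes the
    element that the next reindexing strips.\<close>
  also have "(\<Sum>S\<in>X. \<Sum>i\<in>V S. \<Sum>j\<in>S. m (insert i S) * diff i f S * diff j f (insert i (S - {j}))) =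
     (\<Sum>S\<in>X. \<Sum>j\<in>S. \<Sum>i\<in>V S. m (insert i S) * diff i f S * diff j f (insert i (S - {j})))"
    by (intro sum.cong refl sum.swap)
  also have "\<dots> = (\<Sum>S\<in>X. \<Sum>j\<in>V S. \<Sum>i\<in>V (insert j S).
      m (insert i (insert j S)) * diff i f (insert j S) * diff j f (insert i (insert j S - {j})))"
    by (rule sum_reindex_edges)
  also have "\<dots> = (\<Sum>S\<in>X. \<Sum>j\<in>V S. \<Sum>i\<in>V S - {j}.
      m (insert i (insert j S)) * (diff i f (insert j S) * diff j f (insert i S)))"
  proof (rule sum.cong[OF refl], rule sum.cong[OF refl])
    fix S j assume S: "S \<in> X" and j: "j \<in> V S"
    then have "insert j S - {j} = S" by (auto simp: V_mem)
    then show "(\<Sum>i\<in>V (insert j S).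
        m (insert i (insert j S)) * diff i f (insert j S) * diff j f (insert i (insert j S - {j}))) =
      (\<Sum>i\<in>V S - {j}. m (insert i (insert j S)) * (diff i f (insert j S) * diff j f (insert i S)))"
      using sum_V_insert[OF S j, of "\<lambda>i. diff i f (insert j S) * diff j f (insert i S)"]
      by (simp add: mult.assoc)
  qed
  finally show ?thesis .
qed

text \<open>The normalising constant of the conditional distribution cancels, so
  \<open>M_matrix n X \<mu> S i j + 1\<close> equals \<open>m (insert i (insert j S)) * m S / (m
  (insert i S) * m (insert j S))\<close>.\<close>

lemma M_matrix_eq:
  assumes S: "S \<in> X" and i: "i \<in> V S" and j: "j \<in> V S" and ij: "i \<noteq> j"
  shows "m S * (ratio \<mu> S i * M_matrix n X \<mu> S i j * ratio \<mu> S j) =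
         m (insert i (insert j S)) - m S * (ratio \<mu> S i * ratio \<mu> S j)"
proof -
  define Z where "Z = (\<Sum>U\<in>link n X S. m (S \<union> U))"
  have fin: "finite (link n X S)"
    by (rule finite_subset[of _ "Pow {1..n}"]) (auto simp: link_def)
  have empty: "{} \<in> link n X S" using S by (auto simp: link_def)
  have "Z > 0" unfolding Z_def
    by (rule sum_pos2[OF fin empty]) (use m_pos[OF S] in auto)
  \<comment> \<open>Outside the link both sides are zero because \<open>m\<close> vanishes off
    \<open>X\<close>; this matters for \<open>{i, j}\<close>, which need not lie in the
    link.\<close>
  have c: "cond_mass n X \<mu> S T = m (S \<union> T) / Z" if "T \<subseteq> {1..n} - S" for T
    using that m_zero by (auto simp: cond_mass_def Z_def link_def)
  have sub: "{i} \<subseteq> {1..n} - S" "{j} \<subseteq> {1..n} - S" "{i,j} \<subseteq> {1..n} - S"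
    using i j by (auto simp: V_mem)
  have pos: "m S > 0" "m (insert i S) > 0" "m (insert j S) > 0"
    using S i j by (auto simp: V_mem m_pos)
  have U: "S \<union> {i,j} = insert i (insert j S)" by auto
  show ?thesis
    using ij pos \<open>Z > 0\<close>
    by (simp add: M_matrix_def c[OF sub(1)] c[OF sub(2)] c[OF sub(3)] c[of "{}"] ratio_def U)
       (simp add: field_simps)
qed

lemma sum_offdiag_swap:
  fixes h :: "nat \<Rightarrow> nat \<Rightarrow> real"
  assumes "finite A"
  shows "(\<Sum>j\<in>A. \<Sum>i\<in>A - {j}. h i j) = (\<Sum>j\<in>A. \<Sum>i\<in>A - {j}. h j i)"
proof -
  have *: "(\<Sum>j\<in>A. \<Sum>i\<in>A - {j}. h i j) = (\<Sum>j\<in>A. \<Sum>i\<in>A. if i = j then 0 else h i j)" for h :: "nat \<Rightarrow> nat \<Rightarrow> real"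
    using assms by (intro sum.cong refl sum.mono_neutral_cong_left) auto
  show ?thesis
    unfolding * by (subst sum.swap) (auto intro!: sum.cong)
qed

text \<open>With \<open>a i = D\<^sub>i f(S)\<close> and the symmetric second difference \<open>c i j = D\<^sub>i f(S + j) - D\<^sub>i f(S)\<close>, the
  mixed terms of the square of the generator sum to \<open>c\<^sup>2 - a i * a j\<close>, up to a part that is
  antisymmetric in \<open>i, j\<close>.\<close>

lemma second_order_terms_ge:
  "(\<Sum>j\<in>V S. \<Sum>i\<in>V S - {j}. m (insert i (insert j S)) *
      (diff i f (insert j S) * diff j f (insert i S) - 2 * (diff i f (insert j S) * diff j f S)))
   \<ge> - (\<Sum>j\<in>V S. \<Sum>i\<in>V S - {j}. m (insert i (insert j S)) * (diff i f S * diff j f S))"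
proof -
  define w where "w i j = m (insert i (insert j S))" for i j
  define a where "a i = diff i f S" for i
  define c where "c i j = diff i f (insert j S) - a i" for i j
  have wsym: "w i j = w j i" for i j by (simp add: w_def insert_commute)
  have csym: "c i j = c j i" for i j by (simp add: c_def a_def diff_def insert_commute)
  have d: "diff i f (insert j S) = a i + c i j" for i j by (simp add: c_def)
  have w0: "w i j \<ge> 0" for i j by (simp add: w_def)
  have anti: "(\<Sum>j\<in>V S. \<Sum>i\<in>V S - {j}. w i j * (c i j * a i)) =
      (\<Sum>j\<in>V S. \<Sum>i\<in>V S - {j}. w i j * (c i j * a j))"
    by (subst sum_offdiag_swap) (auto simp: wsym csym intro!: sum.cong) 
  have eq: "w i j * ((a i + c i j) * (a j + c j i) - 2 * ((a i + c i j) * a j)) =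
     w i j * (c i j)\<^sup>2 + w i j * (c i j * a i) - w i j * (c i j * a j) - w i j * (a i * a j)" for i j
    unfolding csym[of j i] by (simp add: power2_eq_square algebra_simps)
  have "(\<Sum>j\<in>V S. \<Sum>i\<in>V S - {j}. w i j * ((a i + c i j) * (a j + c j i) - 2 * ((a i + c i j) * a j)))
      = (\<Sum>j\<in>V S. \<Sum>i\<in>V S - {j}. w i j * (c i j)\<^sup>2) - (\<Sum>j\<in>V S. \<Sum>i\<in>V S - {j}. w i j * (a i * a j))"
    unfolding eq sum.distrib sum_subtractf anti by simp
  moreover have "(\<Sum>j\<in>V S. \<Sum>i\<in>V S - {j}. w i j * (c i j)\<^sup>2) \<ge> 0"
    by (intro sum_nonneg mult_nonneg_nonneg w0) auto
  ultimately show ?thesis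
    by (simp add: d w_def[symmetric] a_def[symmetric])
qed

text \<open>The Loewner condition is tested on \<open>x i = ratio \<mu> S i * a i\<close> and scaled
  by \<open>m S\<close>. The inverse ratios turn into the edge weights, and the identity supplies
  the diagonal that completes the products \<open>x i * x j\<close> to the square of the
  sum.\<close>

lemma loewner_sum_le:
  assumes S: "S \<in> X"
    and L: "loewner_le (V S) (M_matrix n X \<mu> S)
          (\<lambda>i j. diag_matrix (\<lambda>_. 1) i j
                 + (1 - \<delta>) * diag_matrix (\<lambda>k. inverse (ratio \<mu> S k)) i j)"
  shows "(\<Sum>j\<in>V S. \<Sum>i\<in>V S - {j}. m (insert i (insert j S)) * (a i * a j)) - m S * (\<Sum>i\<in>V S. ratio \<mu> S i * a i)\<^sup>2
     \<le> (1 - \<delta>) * (\<Sum>i\<in>V S. m (insert i S) * a i * a i)"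
proof -
  define r where "r = ratio \<mu> S"
  define x where "x i = r i * a i" for i
  define M where "M = M_matrix n X \<mu> S"
  have rpos: "r i > 0" if "i \<in> V S" for i
    using that S by (auto simp: r_def ratio_def V_mem m_pos)
  have "0 \<le> (\<Sum>j\<in>V S. \<Sum>i\<in>V S. x j * (diag_matrix (\<lambda>_. 1) j i
                 + (1 - \<delta>) * diag_matrix (\<lambda>k. inverse (r k)) j i - M j i) * x i)"
    using L unfolding loewner_le_def psd_on_def M_def r_def by blast
  also have "\<dots> = (\<Sum>j\<in>V S. (x j)\<^sup>2 + (1 - \<delta>) * (inverse (r j) * (x j)\<^sup>2) - (\<Sum>i\<in>V S - {j}. x j * M j i * x i))"
  proof (intro sum.cong refl)
    fix j assume j: "j \<in> V S"
    show "(\<Sum>i\<in>V S. x j * (diag_matrix (\<lambda>_. 1) j i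
                 + (1 - \<delta>) * diag_matrix (\<lambda>k. inverse (r k)) j i - M j i) * x i) =
        (x j)\<^sup>2 + (1 - \<delta>) * (inverse (r j) * (x j)\<^sup>2) - (\<Sum>i\<in>V S - {j}. x j * M j i * x i)"
      unfolding sum.remove[OF finite_V j]
      by (auto simp: diag_matrix_def M_def M_matrix_def[of _ _ _ _ j j] power2_eq_square algebra_simps sum_negf)
  qed
  finally have "0 \<le> m S * (\<Sum>j\<in>V S. (x j)\<^sup>2 + (1 - \<delta>) * (inverse (r j) * (x j)\<^sup>2) - (\<Sum>i\<in>V S - {j}. x j * M j i * x i))"
    using m_pos[OF S] by simp
  also have "\<dots> = (\<Sum>j\<in>V S. m S * (x j)\<^sup>2 + (1 - \<delta>) * (m (insert j S) * a j * a j)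
      - (\<Sum>i\<in>V S - {j}. m (insert i (insert j S)) * (a i * a j) - m S * (x i * x j)))"
    unfolding sum_distrib_left
  proof (intro sum.cong refl)
    fix j assume j: "j \<in> V S"
    have 1: "m S * (inverse (r j) * (x j)\<^sup>2) = m (insert j S) * a j * a j"
      using rpos[OF j] m_ratio[OF S, of j] by (simp add: x_def r_def[symmetric] power2_eq_square field_simps)
    have 2: "m S * (x j * M j i * x i) = m (insert i (insert j S)) * (a i * a j) - m S * (x i * x j)"
      if i: "i \<in> V S - {j}" for i
    proof -
      have "m S * (x j * M j i * x i) = m S * (r j * M j i * r i) * (a i * a j)"
        by (simp add: x_def)
      also have "m S * (r j * M j i * r i) = m (insert i (insert j S)) - m S * (r j * r i)"
        using M_matrix_eq[OF S j, of i] i by (simp add: r_def M_def insert_commute)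
      finally show ?thesis by (simp add: x_def algebra_simps)
    qed
    have 3: "m S * (\<Sum>i\<in>V S - {j}. x j * M j i * x i) = (\<Sum>i\<in>V S - {j}. m (insert i (insert j S)) * (a i * a j) - m S * (x i * x j))"
      unfolding sum_distrib_left by (intro sum.cong refl 2)
    show "m S * ((x j)\<^sup>2 + (1 - \<delta>) * (inverse (r j) * (x j)\<^sup>2) - (\<Sum>i\<in>V S - {j}. x j * M j i * x i)) =
      m S * (x j)\<^sup>2 + (1 - \<delta>) * (m (insert j S) * a j * a j)
      - (\<Sum>i\<in>V S - {j}. m (insert i (insert j S)) * (a i * a j) - m S * (x i * x j))"
      unfolding 1[symmetric] 3[symmetric] by (simp add: algebra_simps)
  qed
  also have "\<dots> = (1 - \<delta>) * (\<Sum>j\<in>V S. m (insert j S) * a j * a j) + (\<Sum>j\<in>V S. m S * (x j)\<^sup>2 + (\<Sum>i\<in>V S - {j}. m S * (x i * x j)))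
      - (\<Sum>j\<in>V S. \<Sum>i\<in>V S - {j}. m (insert i (insert j S)) * (a i * a j))"
    by (simp add: sum.distrib sum_subtractf sum_distrib_left)
  also have "(\<Sum>j\<in>V S. m S * (x j)\<^sup>2 + (\<Sum>i\<in>V S - {j}. m S * (x i * x j))) = (\<Sum>j\<in>V S. \<Sum>i\<in>V S. m S * (x i * x j))"
    by (intro sum.cong refl) (simp add: sum.remove[OF finite_V] power2_eq_square)
  also have "\<dots> = m S * (\<Sum>i\<in>V S. x i)\<^sup>2"
    by (simp add: power2_eq_square sum_product sum_distrib_left mult_ac)
  finally show ?thesis by (simp add: x_def r_def)
qed

text \<open>For each \<open>S\<close>, \<open>loewner_sum_le\<close> controls what
  \<open>second_order_terms_ge\<close> leaves, and its squared sum is cancelled by the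
  \<open>up\<close> part of the expansion. In total
  \<open>energy f f - (1 - \<delta>) * energy f f\<close> remains.\<close>

lemma ip_gen_gen_ge:
  assumes L: "\<And>S. S \<in> X \<Longrightarrow> loewner_le (V S) (M_matrix n X \<mu> S)
          (\<lambda>i j. diag_matrix (\<lambda>_. 1) i j
                 + (1 - \<delta>) * diag_matrix (\<lambda>k. inverse (ratio \<mu> S k)) i j)"
  shows "ip (gen f) (gen f) \<ge> \<delta> * energy f f"
proof -
  let ?W = "\<lambda>S i j. m (insert i (insert j S))"
  have "ip (gen f) (gen f) = (\<Sum>S\<in>X. m S * (up f S)\<^sup>2)
     + (\<Sum>S\<in>X. m S * (down f S * down f S)) - 2 * (\<Sum>S\<in>X. m S * (up f S * down f S))"
    by (simp add: ip_def gen_def sum_distrib_left sum.distrib[symmetric] sum_subtractf[symmetric]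
        power2_eq_square algebra_simps)
  also have "\<dots> = energy f f + (\<Sum>S\<in>X. m S * (up f S)\<^sup>2 + (\<Sum>j\<in>V S. \<Sum>i\<in>V S - {j}. ?W S i j *
      (diff i f (insert j S) * diff j f (insert i S) - 2 * (diff i f (insert j S) * diff j f S))))"
    unfolding ip_gen_up_down ip_gen_down_down
    by (simp add: sum.distrib sum_subtractf right_diff_distrib sum_distrib_left mult_ac)
  also have "\<dots> \<ge> energy f f + (\<Sum>S\<in>X. - ((1 - \<delta>) * (\<Sum>i\<in>V S. m (insert i S) * diff i f S * diff i f S)))"
  proof (intro add_left_mono sum_mono)
    fix S assume S: "S \<in> X"
    show "- ((1 - \<delta>) * (\<Sum>i\<in>V S. m (insert i S) * diff i f S * diff i f S)) \<le>
      m S * (up f S)\<^sup>2 + (\<Sum>j\<in>V S. \<Sum>i\<in>V S - {j}. ?W S i j *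
      (diff i f (insert j S) * diff j f (insert i S) - 2 * (diff i f (insert j S) * diff j f S)))"
      using loewner_sum_le[OF S L[OF S], of "\<lambda>i. diff i f S"] second_order_terms_ge[of S f]
      unfolding up_def by linarith
  qed
  also have "energy f f + (\<Sum>S\<in>X. - ((1 - \<delta>) * (\<Sum>i\<in>V S. m (insert i S) * diff i f S * diff i f S))) = \<delta> * energy f f"
    by (simp only: sum_negf sum_distrib_left[symmetric] energy_def[symmetric]) (simp add: algebra_simps)
  finally show ?thesis .
qed


subsection \<open>The Poincare inequality\<close>

lemma ip_nonneg: "ip f f \<ge> 0"
  by (auto simp: ip_def mult.assoc intro!: sum_nonneg)

lemma ip_sym: "ip f g = ip g f"
  by (simp add: ip_def mult_ac)

lemma ip_add_scaled: "ip h (\<lambda>S. f S + c * g S) = ip h f + c * ip h g"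
  by (simp add: ip_def algebra_simps sum.distrib sum_distrib_left)

lemma energy_add_scaled: "energy h (\<lambda>S. f S + c * g S) = energy h f + c * energy h g"
  by (simp add: energy_def diff_def algebra_simps sum.distrib sum_subtractf sum_distrib_left)

lemma ip_square_add_scaled:
  "ip (\<lambda>S. f S + c * g S) (\<lambda>S. f S + c * g S) = ip f f + 2 * c * ip f g + c\<^sup>2 * ip g g"
  by (simp add: ip_add_scaled ip_sym[of "\<lambda>S. f S + c * g S" f] ip_sym[of "\<lambda>S. f S + c * g S" g]
      ip_sym[of g f] power2_eq_square distrib_left)

lemma energy_square_add_scaled:
  "energy (\<lambda>S. f S + c * g S) (\<lambda>S. f S + c * g S) =
     energy f f + 2 * c * energy f g + c\<^sup>2 * energy g g"
  by (simp add: energy_add_scaled energy_sym[of "\<lambda>S. f S + c * g S" f]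
      energy_sym[of "\<lambda>S. f S + c * g S" g] energy_sym[of g f] power2_eq_square distrib_left)

lemma square_le_ip: "S \<in> X \<Longrightarrow> m S * (f S)\<^sup>2 \<le> ip f f"
  unfolding ip_def power2_eq_square mult.assoc[symmetric]
  using finite_X by (intro member_le_sum[where f = "\<lambda>S. m S * f S * f S"]) (auto simp: mult.assoc)

lemma square_diff_le_energy:
  assumes "S \<in> X" "i \<in> V S"
  shows "m (insert i S) * (diff i f S)\<^sup>2 \<le> energy f f"
proof -
  have "m (insert i S) * (diff i f S)\<^sup>2 \<le> (\<Sum>i\<in>V S. m (insert i S) * (diff i f S)\<^sup>2)"
    using assms by (intro member_le_sum) auto
  also have "\<dots> \<le> (\<Sum>S\<in>X. \<Sum>i\<in>V S. m (insert i S) * (diff i f S)\<^sup>2)"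
    using assms finite_X
    by (intro member_le_sum[where f = "\<lambda>S. \<Sum>i\<in>V S. m (insert i S) * (diff i f S)\<^sup>2"])
       (auto intro!: sum_nonneg)
  finally show ?thesis by (simp add: energy_def power2_eq_square mult.assoc)
qed

text \<open>In \<open>poincare\<close> this \<open>K\<close> sets the step size \<open>1 / K\<close>
  and then drops out of the final constant; \<open>K \<ge> 1\<close> keeps
  \<open>1 - \<delta> / K\<close> nonnegative there.\<close>

lemma energy_le_ip: "\<exists>K\<ge>1. \<forall>f. energy f f \<le> K * ip f f"
proof -
  define B where "B S i = 2 + 2 * (m (insert i S) / m S)" for S i
  have B0: "B S i \<ge> 0" for S i by (simp add: B_def)
  have edge: "m (insert i S) * diff i f S * diff i f S \<le> B S i * ip f f" if S: "S \<in> X" and i: "i \<in> V S" for f S i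
  proof -
    have sq: "(a - b) * (a - b) \<le> 2 * a\<^sup>2 + 2 * b\<^sup>2" for a b :: real
      using zero_le_power2[of "a + b"] by (simp add: power2_eq_square algebra_simps)
    have iS: "insert i S \<in> X" using i by (simp add: V_mem)
    have "m (insert i S) * diff i f S * diff i f S \<le>
        m (insert i S) * (2 * (f (insert i S))\<^sup>2 + 2 * (f S)\<^sup>2)"
      unfolding diff_def mult.assoc by (intro mult_left_mono sq) simp
    also have "\<dots> = 2 * (m (insert i S) * (f (insert i S))\<^sup>2) + 2 * (m (insert i S) / m S) * (m S * (f S)\<^sup>2)"
      using m_pos[OF S] by (simp add: algebra_simps)
    also have "\<dots> \<le> 2 * ip f f + 2 * (m (insert i S) / m S) * ip f f"
      by (intro add_mono mult_left_mono square_le_ip S iS) auto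
    finally show ?thesis by (simp add: B_def algebra_simps)
  qed
  define K where "K = 1 + (\<Sum>S\<in>X. \<Sum>i\<in>V S. B S i)"
  have "K \<ge> 1" unfolding K_def using B0 by (simp add: sum_nonneg)
  moreover have "energy f f \<le> K * ip f f" for f
  proof -
    have "energy f f \<le> (\<Sum>S\<in>X. \<Sum>i\<in>V S. B S i * ip f f)"
      unfolding energy_def by (intro sum_mono edge)
    also have "\<dots> \<le> K * ip f f"
      using ip_nonneg[of f] by (simp add: K_def sum_distrib_right distrib_right)
    finally show ?thesis .
  qed
  ultimately show ?thesis by blast
qed

text \<open>Bias-variance decomposition, applied below with \<open>c\<close> equal to
  \<open>f {}\<close> and to the mean.\<close>

lemma sum_square_centered:
  "(\<Sum>S\<in>X. m S * (f S - c)\<^sup>2) = var f + (ip (\<lambda>_. 1) f - c)\<^sup>2"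
proof -
  have "(\<Sum>S\<in>X. m S * (f S - c)\<^sup>2) = ip f f - 2 * c * ip (\<lambda>_. 1) f + c\<^sup>2 * (\<Sum>S\<in>X. m S)"
    by (simp add: ip_def sum_distrib_left sum.distrib[symmetric] sum_subtractf[symmetric]
        power2_eq_square algebra_simps)
  then show ?thesis
    unfolding sum_m var_def by (simp add: power2_eq_square algebra_simps)
qed

text \<open>Downward closure connects \<open>{}\<close> to every member of \<open>X\<close> by
  single insertions inside \<open>X\<close>, and each insertion is controlled by one edge of the
  energy. The constant may be poor, since it only starts the iteration in
  \<open>poincare\<close>.\<close>

lemma var_le_energy: "\<exists>c\<ge>0. \<forall>f. var f \<le> c * energy f f"
proof -
  have path: "S \<in> X \<Longrightarrow> \<exists>c\<ge>0. \<forall>f. (f S - f {})\<^sup>2 \<le> c * energy f f" if "finite S" for S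
    using that
  proof (induction S rule: finite_induct)
    case empty
    then show ?case by (intro exI[of _ 0]) auto
  next
    case (insert i S)
    have S: "S \<in> X" using insert.prems by (rule X_subD) auto
    have i: "i \<in> V S" using insert by (intro V_memX) auto
    obtain c where c: "c \<ge> 0" "\<And>f. (f S - f {})\<^sup>2 \<le> c * energy f f"
      using insert.IH[OF S] by blast
    have "(f (insert i S) - f {})\<^sup>2 \<le> (2 / m (insert i S) + 2 * c) * energy f f" for f
    proof -
      have sq: "(a + b)\<^sup>2 \<le> 2 * a\<^sup>2 + 2 * b\<^sup>2" for a b :: real
        using zero_le_power2[of "a - b"] by (simp add: power2_eq_square algebra_simps)
      have "(f (insert i S) - f {})\<^sup>2 \<le> 2 * (diff i f S)\<^sup>2 + 2 * (f S - f {})\<^sup>2"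
        using sq[of "diff i f S" "f S - f {}"] by (simp add: diff_def)
      moreover have "(diff i f S)\<^sup>2 \<le> energy f f / m (insert i S)"
        using square_diff_le_energy[OF S i, of f] m_pos[OF insert.prems] by (simp add: field_simps)
      ultimately show ?thesis using c(2)[of f] by (simp add: algebra_simps)
    qed
    then show ?case using c(1) by (intro exI[of _ "2 / m (insert i S) + 2 * c"]) auto
  qed
  then have "\<forall>S\<in>X. \<exists>c\<ge>0. \<forall>f. (f S - f {})\<^sup>2 \<le> c * energy f f"
    using X_finite_mem by blast
  then obtain c where c: "\<And>S. S \<in> X \<Longrightarrow> c S \<ge> 0"
    "\<And>S f. S \<in> X \<Longrightarrow> (f S - f {})\<^sup>2 \<le> c S * energy f f" by metis
  have "var f \<le> (\<Sum>S\<in>X. m S * c S) * energy f f" for f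
  proof -
    have "var f \<le> (\<Sum>S\<in>X. m S * (f S - f {})\<^sup>2)"
      unfolding sum_square_centered by simp
    also have "\<dots> \<le> (\<Sum>S\<in>X. m S * (c S * energy f f))"
      by (intro sum_mono mult_left_mono c) auto
    finally show ?thesis by (simp add: sum_distrib_right mult.assoc)
  qed
  then show ?thesis using c(1) by (intro exI[of _ "\<Sum>S\<in>X. m S * c S"]) (auto intro!: sum_nonneg)
qed

text \<open>For large \<open>K\<close> the map \<open>Q = I + gen / K\<close> contracts the energy by \<open>1 - \<delta> / K\<close>, while the
  variance drops by at most \<open>2 * energy f f / K\<close>. Hence a Poincare constant \<open>c\<close> improves to
  \<open>2 / K + c * (1 - \<delta> / K)\<close>, and iterating this yields the fixed point \<open>2 / \<delta>\<close>.\<close>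

lemma poincare:
  assumes \<delta>: "0 < \<delta>" "\<delta> < 1"
    and gap: "\<And>f. ip (gen f) (gen f) \<ge> \<delta> * energy f f"
  shows "var f \<le> 2 / \<delta> * energy f f"
proof -
  obtain K where K: "K \<ge> 1" "\<And>f. energy f f \<le> K * ip f f" using energy_le_ip by blast
  obtain c0 where c0: "c0 \<ge> 0" "\<And>f. var f \<le> c0 * energy f f" using var_le_energy by blast
  define \<rho> where "\<rho> = 1 - \<delta> / K"
  have \<rho>: "0 \<le> \<rho>" "\<rho> < 1" using \<delta> K(1) by (auto simp: \<rho>_def field_simps)
  define Q where "Q f S = f S + (1 / K) * gen f S" for f S
  have Q: "Q f = (\<lambda>S. f S + (1 / K) * gen f S)" for f by (simp add: Q_def fun_eq_iff)
  have step_var: "var f \<le> 2 / K * energy f f + var (Q f)" for f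
  proof -
    \<comment> \<open>The generator has mean zero: its pairing with a constant is an energy with
      vanishing differences.\<close>
    have mean: "ip (\<lambda>_. 1) (Q f) = ip (\<lambda>_. 1) f"
      unfolding Q ip_add_scaled ip_gen by (simp add: energy_def diff_def)
    have "ip (Q f) (Q f) = ip f f - 2 / K * energy f f + 1 / K\<^sup>2 * ip (gen f) (gen f)"
      unfolding Q ip_square_add_scaled ip_gen[of f f] by (simp add: power2_eq_square)
    moreover have "1 / K\<^sup>2 * ip (gen f) (gen f) \<ge> 0" using ip_nonneg by simp
    ultimately show ?thesis unfolding var_def mean by simp
  qed
  have step_energy: "energy (Q f) (Q f) \<le> \<rho> * energy f f" for f
  proof -
    have eg: "energy (gen f) f = - ip (gen f) (gen f)" by (simp add: ip_gen)
    have "energy (Q f) (Q f) = energy f f - 2 / K * ip (gen f) (gen f) + 1 / K * (energy (gen f) (gen f) / K)"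
      unfolding Q energy_square_add_scaled energy_sym[of f "gen f"] eg by (simp add: power2_eq_square)
    \<comment> \<open>By the choice of \<open>K\<close>, applied to \<open>gen f\<close>, half of
      the first-order gain pays for the second-order term.\<close>
    also have "\<dots> \<le> energy f f - 2 / K * ip (gen f) (gen f) + 1 / K * ip (gen f) (gen f)"
      using K(1) K(2)[of "gen f"] by (intro add_left_mono mult_left_mono) (auto simp: field_simps)
    also have "\<dots> = energy f f - 1 / K * ip (gen f) (gen f)" by (simp add: field_simps)
    also have "\<dots> \<le> energy f f - 1 / K * (\<delta> * energy f f)"
      using K(1) by (intro diff_left_mono mult_left_mono gap) auto
    finally show ?thesis by (simp add: \<rho>_def algebra_simps)
  qed
  have bound: "var f \<le> (2 / \<delta> + \<rho> ^ k * c0) * energy f f" for k f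
  proof (induction k arbitrary: f)
    case 0
    have "var f \<le> c0 * energy f f" by (rule c0)
    also have "\<dots> \<le> (2 / \<delta> + c0) * energy f f"
      using \<delta> by (intro mult_right_mono energy_nonneg) auto
    finally show ?case by simp
  next
    case (Suc k)
    have "var f \<le> 2 / K * energy f f + var (Q f)" by (rule step_var)
    also have "\<dots> \<le> 2 / K * energy f f + (2 / \<delta> + \<rho> ^ k * c0) * energy (Q f) (Q f)"
      by (intro add_left_mono Suc)
    also have "\<dots> \<le> 2 / K * energy f f + (2 / \<delta> + \<rho> ^ k * c0) * (\<rho> * energy f f)"
      using \<delta> \<rho> c0(1) by (intro add_left_mono mult_left_mono step_energy) auto
    also have "\<dots> = (2 / K + 2 / \<delta> * \<rho> + \<rho> ^ Suc k * c0) * energy f f" by (simp add: algebra_simps)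
    also have "2 / K + 2 / \<delta> * \<rho> = 2 / \<delta>" using \<delta> K(1) by (simp add: \<rho>_def field_simps)
    finally show ?case .
  qed
  \<comment> \<open>Since \<open>\<rho> < 1\<close>, the limit in \<open>k\<close> erases the
    initial constant \<open>c0\<close>.\<close>
  have "(\<lambda>k. (2 / \<delta> + \<rho> ^ k * c0) * energy f f) \<longlonglongrightarrow> (2 / \<delta> + 0 * c0) * energy f f"
    using \<rho> by (intro tendsto_intros LIMSEQ_power_zero) auto
  then show ?thesis using bound by (intro LIMSEQ_le_const) auto
qed

subsection \<open>Contraction of the variance under Glauber dynamics\<close>

text \<open>For \<open>S\<close> in \<open>X\<close> this is the conditional expectation of
  \<open>f\<close> given membership of all elements other than \<open>i\<close>. If
  \<open>insert i S\<close> is not in \<open>X\<close>, its mass is zero and the formula yields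
  \<open>f (S - {i})\<close>, which matches the forced move of the dynamics.\<close>

definition heat_bath :: "nat \<Rightarrow> (nat set \<Rightarrow> real) \<Rightarrow> nat set \<Rightarrow> real" where
  "heat_bath i f S = (m (S - {i}) * f (S - {i}) + m (insert i S) * f (insert i S)) /
     (m (S - {i}) + m (insert i S))"

definition glauber_op :: "(nat set \<Rightarrow> real) \<Rightarrow> nat set \<Rightarrow> real" where
  "glauber_op f S = (\<Sum>i\<in>{1..n}. heat_bath i f S) / n"

text \<open>Deleting \<open>i\<close> splits \<open>X\<close> into fibres \<open>S\<close>,
  \<open>insert i S\<close>; an upper set missing from \<open>X\<close> contributes mass
  zero.\<close>

lemma sum_fibers:
  "(\<Sum>S\<in>X. m S * h S) = (\<Sum>S | S \<in> X \<and> i \<notin> S. m S * h S + m (insert i S) * h (insert i S))"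
proof -
  have "(\<Sum>S\<in>X. m S * h S) = (\<Sum>S\<in>{S\<in>X. i \<notin> S} \<union> {S\<in>X. i \<in> S}. m S * h S)"
    by (intro sum.cong) auto
  also have "\<dots> = (\<Sum>S | S \<in> X \<and> i \<notin> S. m S * h S) + (\<Sum>S | S \<in> X \<and> i \<in> S. m S * h S)"
    using finite_X by (intro sum.union_disjoint) auto
  also have "(\<Sum>S | S \<in> X \<and> i \<in> S. m S * h S) =
      (\<Sum>S | S \<in> X \<and> i \<notin> S \<and> insert i S \<in> X. m (insert i S) * h (insert i S))"
    by (rule sum.reindex_bij_witness[of _ "insert i" "\<lambda>S. S - {i}"])
       (auto simp: insert_absorb intro: X_subD)
  also have "\<dots> = (\<Sum>S | S \<in> X \<and> i \<notin> S. m (insert i S) * h (insert i S))"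
    using finite_X m_zero by (intro sum.mono_neutral_left) auto
  finally show ?thesis by (simp add: sum.distrib)
qed

lemma heat_bath_eq:
  assumes "i \<notin> S"
  shows "heat_bath i f S = (m S * f S + m (insert i S) * f (insert i S)) / (m S + m (insert i S))"
    and "heat_bath i f (insert i S) = heat_bath i f S"
  using assms by (simp_all add: heat_bath_def)

lemma ip_one_heat_bath: "ip (\<lambda>_. 1) (heat_bath i f) = ip (\<lambda>_. 1) f"
proof -
  have "m S * heat_bath i f S + m (insert i S) * heat_bath i f (insert i S) =
      m S * f S + m (insert i S) * f (insert i S)" if "S \<in> X" "i \<notin> S" for S
  proof -
    have "m S + m (insert i S) > 0" using m_pos[OF that(1)] by (simp add: add_pos_nonneg)
    then show ?thesis
      unfolding heat_bath_eq(2)[OF that(2)] distrib_right[symmetric] heat_bath_eq(1)[OF that(2)] by simp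
  qed
  then show ?thesis
    unfolding ip_def mult_1_right by (simp add: sum_fibers[where i = i])
qed

lemma ratio_le_r_max: "S \<in> X \<Longrightarrow> i \<in> V S \<Longrightarrow> ratio \<mu> S i \<le> r_max n X \<mu>"
  unfolding r_max_def using finite_X by (intro Max_ge) auto

lemma r_max_nonneg: "r_max n X \<mu> \<ge> 0"
  unfolding r_max_def using finite_X by (intro Max_ge) auto

text \<open>Averaging over a fibre with masses \<open>p\<close>, \<open>q\<close> and values
  \<open>a\<close>, \<open>b\<close> loses \<open>p * q * (b - a)\<^sup>2 / (p + q)\<close>. Since
  \<open>q \<le> R * p\<close>, the factor \<open>p / (p + q)\<close> is at least
  \<open>1 / (1 + R)\<close>.\<close>

lemma ip_heat_bath_le:
  "ip (heat_bath i f) (heat_bath i f) \<le> ip f f -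
     (\<Sum>S | S \<in> X \<and> i \<notin> S. m (insert i S) * (diff i f S)\<^sup>2) / (1 + r_max n X \<mu>)"
proof -
  let ?h = "heat_bath i f"
  define R where "R = r_max n X \<mu>"
  have R: "R \<ge> 0" by (simp add: R_def r_max_nonneg)
  have main: "m S * (?h S * ?h S) + m (insert i S) * (?h (insert i S) * ?h (insert i S)) \<le>
      m S * (f S * f S) + m (insert i S) * (f (insert i S) * f (insert i S)) -
      m (insert i S) * (diff i f S)\<^sup>2 / (1 + R)" if S: "S \<in> X" and i: "i \<notin> S" for S
  proof -
    define p q where "p = m S" and "q = m (insert i S)"
    define a b where "a = f S" and "b = f (insert i S)"
    have p: "p > 0" and q: "q \<ge> 0" using m_pos[OF S] by (auto simp: p_def q_def)
    have qR: "q \<le> R * p"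
    proof (cases "insert i S \<in> X")
      case True
      then show ?thesis
        using ratio_le_r_max[OF S V_memX[OF True i]] p by (simp add: R_def p_def q_def ratio_def field_simps)
    next
      case False
      then show ?thesis using R p m_zero by (simp add: q_def)
    qed
    have "(p + q) * (((p * a + q * b) / (p + q)) * ((p * a + q * b) / (p + q))) = (p * a + q * b)\<^sup>2 / (p + q)"
      using p q by (simp add: power2_eq_square)
    also have "\<dots> = p * (a * a) + q * (b * b) - p * q * (b - a)\<^sup>2 / (p + q)"
      using p q by (simp add: field_simps power2_eq_square)
    also have "\<dots> \<le> p * (a * a) + q * (b * b) - q * (b - a)\<^sup>2 / (1 + R)"
    proof (intro diff_left_mono)
      have "1 / (1 + R) \<le> p / (p + q)" using p q R qR by (simp add: field_simps)
      then have "(q * (b - a)\<^sup>2) * (1 / (1 + R)) \<le> (q * (b - a)\<^sup>2) * (p / (p + q))"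
        using q by (intro mult_left_mono) auto
      then show "q * (b - a)\<^sup>2 / (1 + R) \<le> p * q * (b - a)\<^sup>2 / (p + q)" by (simp add: mult_ac)
    qed
    finally show ?thesis
      unfolding heat_bath_eq(2)[OF i] distrib_right[symmetric] heat_bath_eq(1)[OF i]
      by (simp add: p_def q_def a_def b_def diff_def)
  qed
  have "ip ?h ?h = (\<Sum>S | S \<in> X \<and> i \<notin> S. m S * (?h S * ?h S) + m (insert i S) * (?h (insert i S) * ?h (insert i S)))"
    unfolding ip_def mult.assoc by (rule sum_fibers)
  also have "\<dots> \<le> (\<Sum>S | S \<in> X \<and> i \<notin> S. m S * (f S * f S) + m (insert i S) * (f (insert i S) * f (insert i S)) -
      m (insert i S) * (diff i f S)\<^sup>2 / (1 + R))"
    using main by (intro sum_mono) auto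
  also have "\<dots> = ip f f - (\<Sum>S | S \<in> X \<and> i \<notin> S. m (insert i S) * (diff i f S)\<^sup>2) / (1 + R)"
    unfolding sum_subtractf ip_def mult.assoc sum_fibers[where i = i, of "\<lambda>S. f S * f S"]
    by (simp add: sum_divide_distrib)
  finally show ?thesis by (simp add: R_def)
qed

text \<open>Every edge has exactly one direction \<open>i\<close>, and pairs that leave
  \<open>X\<close> have weight zero.\<close>

lemma sum_directions_energy:
  "(\<Sum>i\<in>{1..n}. \<Sum>S | S \<in> X \<and> i \<notin> S. m (insert i S) * (diff i f S)\<^sup>2) = energy f f"
proof -
  have "(\<Sum>i\<in>{1..n}. \<Sum>S | S \<in> X \<and> i \<notin> S. m (insert i S) * (diff i f S)\<^sup>2) =
      (\<Sum>S\<in>X. \<Sum>i | i \<in> {1..n} \<and> i \<notin> S. m (insert i S) * (diff i f S)\<^sup>2)"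
    using finite_X by (intro sum.swap_restrict) auto
  also have "\<dots> = (\<Sum>S\<in>X. \<Sum>i\<in>V S. m (insert i S) * (diff i f S)\<^sup>2)"
    by (intro sum.cong refl sum.mono_neutral_right) (auto simp: V_mem m_zero)
  finally show ?thesis by (simp add: energy_def power2_eq_square mult.assoc)
qed

text \<open>Convexity of the square bounds the norm of the average by the average over the
  \<open>n\<close> directions, whose separate losses add up to the full energy.\<close>

lemma ip_glauber_op_le:
  assumes n: "n \<ge> 1"
  shows "ip (glauber_op f) (glauber_op f) \<le> ip f f - energy f f / (n * (1 + r_max n X \<mu>))"
proof -
  have "ip (glauber_op f) (glauber_op f) \<le> (\<Sum>S\<in>X. m S * ((\<Sum>i\<in>{1..n}. (heat_bath i f S)\<^sup>2) / n))"
    unfolding ip_def mult.assoc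
  proof (intro sum_mono mult_left_mono)
    fix S
    have "(\<Sum>i\<in>{1..n}. heat_bath i f S)\<^sup>2 \<le> (\<Sum>i\<in>{1..n}. (heat_bath i f S)\<^sup>2) * n"
      using sum_squared_le_sum_of_squares[of "\<lambda>i. heat_bath i f S" "{1..n}"] by simp
    then show "glauber_op f S * glauber_op f S \<le> (\<Sum>i\<in>{1..n}. (heat_bath i f S)\<^sup>2) / n"
      using n by (simp add: glauber_op_def power2_eq_square field_simps)
  qed simp
  also have "\<dots> = (\<Sum>i\<in>{1..n}. ip (heat_bath i f) (heat_bath i f)) / n"
    unfolding ip_def sum_divide_distrib
    by (subst sum.swap) (simp add: sum_distrib_left power2_eq_square sum_divide_distrib mult.assoc)
  also have "\<dots> \<le> (\<Sum>i\<in>{1..n}. ip f f -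
     (\<Sum>S | S \<in> X \<and> i \<notin> S. m (insert i S) * (diff i f S)\<^sup>2) / (1 + r_max n X \<mu>)) / n"
    by (intro divide_right_mono sum_mono ip_heat_bath_le) auto
  also have "\<dots> = (n * ip f f - energy f f / (1 + r_max n X \<mu>)) / n"
    unfolding sum_subtractf sum_divide_distrib[symmetric] sum_directions_energy by simp
  also have "\<dots> = ip f f - energy f f / (n * (1 + r_max n X \<mu>))"
    using n by (simp add: diff_divide_distrib mult.commute)
  finally show ?thesis .
qed

lemma ip_one_glauber_op:
  assumes n: "n \<ge> 1"
  shows "ip (\<lambda>_. 1) (glauber_op f) = ip (\<lambda>_. 1) f"
proof -
  have "ip (\<lambda>_. 1) (glauber_op f) = (\<Sum>i\<in>{1..n}. ip (\<lambda>_. 1) (heat_bath i f)) / n"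
    unfolding ip_def sum_divide_distrib
    by (subst sum.swap) (simp add: glauber_op_def sum_distrib_left sum_divide_distrib)
  then show ?thesis using n by (simp add: ip_one_heat_bath)
qed

lemma var_glauber_op_le:
  assumes n: "n \<ge> 1" and \<delta>: "\<delta> > 0" and P: "\<And>f. var f \<le> 2 / \<delta> * energy f f"
  shows "var (glauber_op f) \<le> (1 - \<delta> / (2 * n * (1 + r_max n X \<mu>))) * var f"
proof -
  have R: "r_max n X \<mu> \<ge> 0" by (rule r_max_nonneg)
  have "\<delta> / 2 * var f \<le> energy f f" using P[of f] \<delta> by (simp add: field_simps)
  then have "\<delta> / 2 * var f / (n * (1 + r_max n X \<mu>)) \<le> energy f f / (n * (1 + r_max n X \<mu>))"
    using R by (intro divide_right_mono) auto
  moreover have "\<delta> / 2 * var f / (n * (1 + r_max n X \<mu>)) = \<delta> / (2 * n * (1 + r_max n X \<mu>)) * var f"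
    by (simp add: mult.assoc)
  ultimately show ?thesis
    using ip_glauber_op_le[OF n, of f] by (simp add: var_def ip_one_glauber_op[OF n] algebra_simps)
qed

subsection \<open>Mixing time\<close>

lemma set_pmf_glauber:
  assumes n: "n \<ge> 1" and S: "S \<in> X"
  shows "set_pmf (glauber n X \<mu> S) \<subseteq> X"
  using n X_subD[OF S] by (auto simp: glauber_def Let_def set_pmf_of_set split: if_splits)

lemma expectation_glauber:
  assumes n: "n \<ge> 1" and S: "S \<in> X"
  shows "measure_pmf.expectation (glauber n X \<mu> S) f = glauber_op f S"
proof -
  let ?K = "\<lambda>i. let S' = S - {i} in
       if insert i S' \<notin> X then return_pmf S'
       else map_pmf (\<lambda>b. if b then insert i S' else S')
              (bernoulli_pmf (pmf \<mu> (insert i S') / (pmf \<mu> S' + pmf \<mu> (insert i S'))))"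
  have E: "measure_pmf.expectation (?K i) f = heat_bath i f S" for i
  proof -
    have p: "m (S - {i}) > 0" using X_subD[OF S, of "S - {i}"] m_pos by auto
    show ?thesis
    proof (cases "insert i S \<in> X")
      case True
      define q where "q = m (insert i S) / (m (S - {i}) + m (insert i S))"
      have q: "0 \<le> q" "q \<le> 1" and q1: "1 - q = m (S - {i}) / (m (S - {i}) + m (insert i S))"
        using add_pos_nonneg[OF p, of "m (insert i S)"] p by (simp_all add: q_def divide_simps)
      have "measure_pmf.expectation (?K i) f = f (insert i S) * q + f (S - {i}) * (1 - q)"
        using True q by (simp add: Let_def q_def[symmetric])
      also have "\<dots> = heat_bath i f S"
        unfolding q1 by (simp add: heat_bath_def q_def add_divide_distrib mult_ac)
      finally show ?thesis .
    next
      case False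
      then show ?thesis using p m_zero by (simp add: Let_def heat_bath_def)
    qed
  qed
  have "measure_pmf.expectation (glauber n X \<mu> S) f =
      (\<Sum>i\<in>{1..n}. measure_pmf.expectation (?K i) f /\<^sub>R real (card {1..n}))"
    unfolding glauber_def using n
    by (intro pmf_expectation_bind_pmf_of_set) (auto simp: Let_def)
  then show ?thesis
    unfolding E by (simp add: glauber_op_def sum_distrib_left divide_inverse_commute)
qed

lemma set_pmf_kernel_power:
  assumes n: "n \<ge> 1" and x: "x \<in> X"
  shows "set_pmf (kernel_power (glauber n X \<mu>) t x) \<subseteq> X"
  using x set_pmf_glauber[OF n] by (induction t) auto

text \<open>\<open>kernel_power\<close> appends its new step at the end, so that step acts on
  \<open>f\<close> first; hence the induction needs \<open>f\<close> arbitrary.\<close>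

lemma expectation_kernel_power:
  assumes n: "n \<ge> 1" and x: "x \<in> X"
  shows "measure_pmf.expectation (kernel_power (glauber n X \<mu>) t x) f = (glauber_op ^^ t) f x"
proof (induction t arbitrary: f)
  case 0
  then show ?case by simp
next
  case (Suc t)
  let ?p = "kernel_power (glauber n X \<mu>) t x"
  have sub: "set_pmf ?p \<subseteq> X" by (rule set_pmf_kernel_power[OF n x])
  have "measure_pmf.expectation (kernel_power (glauber n X \<mu>) (Suc t) x) f =
      (\<Sum>S\<in>X. pmf ?p S *\<^sub>R measure_pmf.expectation (glauber n X \<mu> S) f)"
    unfolding kernel_power.simps using sub finite_X set_pmf_glauber[OF n]
    by (intro pmf_expectation_bind) (auto intro: finite_subset)
  also have "\<dots> = (\<Sum>S\<in>X. pmf ?p S *\<^sub>R glauber_op f S)"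
    by (simp add: expectation_glauber[OF n])
  also have "\<dots> = measure_pmf.expectation ?p (glauber_op f)"
    using sub by (intro integral_measure_pmf[symmetric] finite_X) auto
  also have "\<dots> = (glauber_op ^^ Suc t) f x"
    by (simp add: Suc funpow_swap1)
  finally show ?case .
qed

text \<open>For \<open>f\<close> the indicator of \<open>A\<close>, the iterated operator at
  \<open>x\<close> gives the probability after \<open>t\<close> steps and its mean stays that of
  \<open>\<mu>\<close>. The left-hand side is then one summand of a variance that starts at most
  \<open>1\<close> and contracts at each step.\<close>

lemma prob_kernel_power_diff:
  assumes n: "n \<ge> 1" and x: "x \<in> X" and \<gamma>: "\<gamma> \<le> 1"
    and contr: "\<And>f. var (glauber_op f) \<le> (1 - \<gamma>) * var f"
  shows "m x * (measure_pmf.prob (kernel_power (glauber n X \<mu>) t x) A - measure_pmf.prob \<mu> A)\<^sup>2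
    \<le> (1 - \<gamma>) ^ t"
proof -
  define f :: "nat set \<Rightarrow> real" where "f = indicator A"
  let ?g = "(glauber_op ^^ t) f"
  have 1: "measure_pmf.prob (kernel_power (glauber n X \<mu>) t x) A = ?g x"
    unfolding expectation_kernel_power[OF n x, symmetric] by (simp add: f_def)
  have mean: "ip (\<lambda>_. 1) ?g = ip (\<lambda>_. 1) f"
    by (induction t) (simp_all add: ip_one_glauber_op[OF n])
  have "measure_pmf.expectation \<mu> f = (\<Sum>S\<in>X. m S *\<^sub>R f S)"
    using finite_X set_pmf_eq_X by (intro integral_measure_pmf) auto
  then have 2: "measure_pmf.prob \<mu> A = ip (\<lambda>_. 1) ?g"
    unfolding mean by (simp add: f_def ip_def)
  have "ip f f \<le> 1"
    unfolding ip_def sum_m[symmetric] by (intro sum_mono) (auto simp: f_def indicator_def)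
  then have var_f: "var f \<le> 1" using zero_le_power2[of "ip (\<lambda>_. 1) f"] unfolding var_def by linarith
  have "var ?g \<le> (1 - \<gamma>) ^ t * var f"
  proof (induction t)
    case (Suc t)
    have "var ((glauber_op ^^ Suc t) f) \<le> (1 - \<gamma>) * var ((glauber_op ^^ t) f)"
      using contr by simp
    also have "\<dots> \<le> (1 - \<gamma>) * ((1 - \<gamma>) ^ t * var f)"
      using \<gamma> by (intro mult_left_mono Suc) auto
    finally show ?case by (simp add: mult.assoc)
  qed simp
  also have "\<dots> \<le> (1 - \<gamma>) ^ t * 1" using \<gamma> var_f by (intro mult_left_mono) auto
  finally have var_g: "var ?g \<le> (1 - \<gamma>) ^ t" by simp
  have "m x * (?g x - ip (\<lambda>_. 1) ?g)\<^sup>2 \<le> (\<Sum>S\<in>X. m S * (?g S - ip (\<lambda>_. 1) ?g)\<^sup>2)"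
    using x finite_X by (intro member_le_sum[where f = "\<lambda>S. m S * (?g S - ip (\<lambda>_. 1) ?g)\<^sup>2"]) auto
  also have "\<dots> = var ?g" by (simp add: sum_square_centered)
  finally show ?thesis unfolding 1 2 using var_g by simp
qed

section \<open>From variance decay to the mixing time bound\<close>

lemma mu_min_pos: "mu_min X \<mu> > 0"
  unfolding mu_min_def using finite_X X_nonempty m_pos by simp

lemma mu_min_le: "S \<in> X \<Longrightarrow> mu_min X \<mu> \<le> m S"
  unfolding mu_min_def using finite_X by simp

text \<open>Two distinct members of \<open>X\<close> share total mass at most \<open>1\<close>. This
  keeps the logarithm in the final bound at least \<open>ln 2\<close>, so that it absorbs additive
  constants.\<close>

lemma mu_min_le_half:
  assumes "X \<noteq> {{}}"
  shows "mu_min X \<mu> \<le> 1 / 2"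
proof -
  obtain S where S: "S \<in> X" "S \<noteq> {}" using assms X_nonempty by auto
  have "m {} + m S = (\<Sum>T\<in>{{}, S}. m T)" using S by simp
  also have "\<dots> \<le> (\<Sum>T\<in>X. m T)" using S empty_in_X finite_X by (intro sum_mono2) auto
  finally show ?thesis using mu_min_le[OF S(1)] mu_min_le[OF empty_in_X] sum_m by simp
qed

text \<open>Here \<open>mu_min X \<mu>\<close> is \<open>1\<close>, so the logarithm in the final
  bound is zero and the mixing time must be exactly \<open>0\<close>.\<close>

lemma mixing_time_trivial:
  assumes "X = {{}}"
  shows "mixing_time X (glauber n X \<mu>) \<mu> = 0"
proof -
  have "\<mu> = return_pmf {}" using set_pmf_eq_X assms by (simp flip: set_pmf_subset_singleton)
  then have "tv_dist (kernel_power (glauber n X \<mu>) 0 {}) \<mu> \<le> 1 / 4" by (simp add: tv_dist_def)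
  then have "(INF t\<in>{t. tv_dist (kernel_power (glauber n X \<mu>) t {}) \<mu> \<le> 1 / 4}. enat t) \<le> enat 0"
    by (intro INF_lower) simp
  then show ?thesis using assms by (simp add: mixing_time_def zero_enat_def[symmetric])
qed

text \<open>The \<open>16\<close> is the square of the \<open>4\<close> in the distance threshold,
  and \<open>mu_min\<close> makes the bound uniform in the starting set.\<close>

lemma mixing_time_le:
  assumes n: "n \<ge> 1" and \<gamma>: "\<gamma> \<le> 1"
    and contr: "\<And>f. var (glauber_op f) \<le> (1 - \<gamma>) * var f"
    and t: "(1 - \<gamma>) ^ t \<le> mu_min X \<mu> / 16"
  shows "mixing_time X (glauber n X \<mu>) \<mu> \<le> enat t"
  unfolding mixing_time_def
proof (intro SUP_least INF_lower CollectI)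
  fix x assume x: "x \<in> X"
  let ?p = "kernel_power (glauber n X \<mu>) t x"
  have "\<bar>measure_pmf.prob ?p A - measure_pmf.prob \<mu> A\<bar> \<le> 1 / 4" for A
  proof -
    let ?d = "measure_pmf.prob ?p A - measure_pmf.prob \<mu> A"
    have "m x * ?d\<^sup>2 \<le> mu_min X \<mu> / 16"
      using prob_kernel_power_diff[OF n x \<gamma> contr] t by (rule order_trans)
    also have "\<dots> \<le> m x * (1 / 4)\<^sup>2" using mu_min_le[OF x] by (simp add: power2_eq_square)
    finally have "?d\<^sup>2 \<le> (1 / 4)\<^sup>2" using m_pos[OF x] by simp
    then show ?thesis by (simp add: abs_le_square_iff[symmetric])
  qed
  then show "tv_dist ?p \<mu> \<le> 1 / 4"
    unfolding tv_dist_def by (intro cSUP_least) auto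
qed

lemma mixing_time_bound:
  assumes \<delta>: "0 < \<delta>" "\<delta> < 1"
    and L: "\<And>S. S \<in> X \<Longrightarrow> \<not> maximal_in n X S \<Longrightarrow> loewner_le (V S) (M_matrix n X \<mu> S)
          (\<lambda>i j. diag_matrix (\<lambda>_. 1) i j
                 + (1 - \<delta>) * diag_matrix (\<lambda>k. inverse (ratio \<mu> S k)) i j)"
  shows "ereal_of_enat (mixing_time X (glauber n X \<mu>) \<mu>)
       \<le> ereal (14 * ((1 + r_max n X \<mu>) * (real n / \<delta>) * ln (1 / mu_min X \<mu>)))"
proof (cases "X = {{}}")
  case True
  have "mu_min X \<mu> = 1" using True sum_m by (simp add: mu_min_def)
  then show ?thesis using mixing_time_trivial[OF True] by (simp add: zero_ereal_def[symmetric])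
next
  case False
  define R where "R = r_max n X \<mu>"
  \<comment> \<open>The factor \<open>\<delta> / 2\<close> is the inverse Poincare constant, and
    \<open>n * (1 + R)\<close> is the cost of passing to Glauber dynamics.\<close>
  define \<gamma> where "\<gamma> = \<delta> / (2 * n * (1 + R))"
  define l where "l = ln (1 / mu_min X \<mu>)"
  define t where "t = nat \<lceil>ln (16 / mu_min X \<mu>) / \<gamma>\<rceil>"
  have R: "R \<ge> 0" by (simp add: R_def r_max_nonneg)
  have n: "n \<ge> 1"
  proof (rule ccontr)
    assume "\<not> n \<ge> 1"
    then have "X \<subseteq> {{}}" using X_subset by simp
    then show False using False X_nonempty by blast
  qed
  \<comment> \<open>For maximal \<open>S\<close> the index set is empty, so the condition holds
    trivially.\<close>
  have loewner: "loewner_le (V S) (M_matrix n X \<mu> S)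
          (\<lambda>i j. diag_matrix (\<lambda>_. 1) i j
                 + (1 - \<delta>) * diag_matrix (\<lambda>k. inverse (ratio \<mu> S k)) i j)" if "S \<in> X" for S
    using L[OF that] by (cases "maximal_in n X S") (simp_all add: maximal_in_def loewner_le_def psd_on_def)
  have contr: "var (glauber_op f) \<le> (1 - \<gamma>) * var f" for f
    unfolding \<gamma>_def R_def using n \<delta>
    by (intro var_glauber_op_le poincare ip_gen_gen_ge loewner) auto
  have nR: "1 \<le> n * (1 + R)" using n R mult_mono[of 1 "real n" 1 "1 + R"] by simp
  have \<gamma>: "0 < \<gamma>" "\<gamma> \<le> 1"
    using \<delta> nR n R by (auto simp: \<gamma>_def divide_simps mult.assoc intro!: mult_pos_pos add_pos_nonneg)
  have mu: "0 < mu_min X \<mu>" "mu_min X \<mu> \<le> 1 / 2" using mu_min_pos mu_min_le_half[OF False] by auto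
  have l: "ln 2 \<le> l" unfolding l_def using mu by (subst ln_le_cancel_iff) (auto simp: field_simps)
  have l16: "ln (16 / mu_min X \<mu>) = l + 4 * ln 2"
    using mu ln_realpow[of 2 4] by (simp add: l_def ln_div)
  \<comment> \<open>Powers preserve \<open>1 - \<gamma> \<le> exp (- \<gamma>)\<close> because
    \<open>\<gamma> \<le> 1\<close>.\<close>
  have "(1 - \<gamma>) ^ t \<le> exp (- \<gamma>) ^ t"
    using \<gamma> exp_ge_add_one_self[of "- \<gamma>"] by (intro power_mono) auto
  also have "\<dots> = exp (- (\<gamma> * t))" by (simp add: exp_of_nat_mult[symmetric] mult_ac)
  also have "\<dots> \<le> exp (- ln (16 / mu_min X \<mu>))"
  proof -
    have "ln (16 / mu_min X \<mu>) / \<gamma> \<le> t" unfolding t_def by (rule real_nat_ceiling_ge)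
    then show ?thesis using \<gamma> by (simp add: field_simps)
  qed
  also have "\<dots> = mu_min X \<mu> / 16" using mu by (simp add: exp_minus)
  finally have "mixing_time X (glauber n X \<mu>) \<mu> \<le> enat t"
    by (intro mixing_time_le[OF n \<gamma>(2) contr])
  then have "ereal_of_enat (mixing_time X (glauber n X \<mu>) \<mu>) \<le> ereal_of_enat (enat t)"
    by (simp only: ereal_of_enat_le_iff)
  also have "\<dots> = ereal (real t)" by simp
  also have "\<dots> \<le> ereal (14 * ((1 + R) * (real n / \<delta>) * l))"
  proof -
    \<comment> \<open>The constant: \<open>ln 16 = 4 * ln 2\<close> is at most \<open>4 * l\<close>,
      giving \<open>5 * l / \<gamma>\<close>; rounding up costs \<open>1\<close>, at most
      \<open>2 * l / \<gamma>\<close>. The sum \<open>7 * l / \<gamma>\<close> doubles to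
      \<open>14\<close> through the \<open>2\<close> in \<open>\<gamma>\<close>.\<close>
    have ln2: "ln 2 \<ge> (1 / 2 :: real)" using ln2_ge_two_thirds by simp
    have "real t \<le> ln (16 / mu_min X \<mu>) / \<gamma> + 1"
    proof -
      have "0 \<le> ln (16 / mu_min X \<mu>) / \<gamma>" using \<gamma> l l16 ln2 by simp
      then show ?thesis unfolding t_def by linarith
    qed
    also have "1 \<le> 2 * l / \<gamma>" using \<gamma> l ln2 by (simp add: field_simps)
    also have "ln (16 / mu_min X \<mu>) / \<gamma> \<le> 5 * l / \<gamma>"
      using \<gamma> l by (intro divide_right_mono) (auto simp: l16)
    finally have "real t \<le> 7 * l / \<gamma>" by (simp add: add_divide_distrib[symmetric])
    also have "\<dots> = 14 * ((1 + R) * (real n / \<delta>) * l)" using \<delta> n R by (simp add: \<gamma>_def field_simps)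
    finally show ?thesis by simp
  qed
  finally show ?thesis by (simp add: R_def l_def)
qed

end

text \<open>The witness \<open>14\<close> is absolute, so the bound is uniform in all parameters.
  Its right-hand side is a real number, which also makes the mixing time finite.\<close>

theorem theorem1p9:
  shows "\<exists>C>0. \<forall>(n::nat) (X :: nat set set) (\<mu> :: nat set pmf) (\<delta> :: real).
     X \<subseteq> Pow {1..n} \<longrightarrow> X \<noteq> {} \<longrightarrow> downward_closed X \<longrightarrow> fully_supported \<mu> X \<longrightarrow>
     0 < \<delta> \<longrightarrow> \<delta> < 1 \<longrightarrow>
     (\<forall>S\<in>X. \<not> maximal_in n X S \<longrightarrow>
        loewner_le (ext_set n X S) (M_matrix n X \<mu> S)
          (\<lambda>i j. diag_matrix (\<lambda>_. 1) i j
                 + (1 - \<delta>) * diag_matrix (\<lambda>k. inverse (ratio \<mu> S k)) i j)) \<longrightarrow>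
     ereal_of_enat (mixing_time X (glauber n X \<mu>) \<mu>)
       \<le> ereal (C * ((1 + r_max n X \<mu>) * (real n / \<delta>) * ln (1 / mu_min X \<mu>)))"
  by (intro exI[of _ 14] conjI allI impI weighted_complex.mixing_time_bound weighted_complex.intro) auto

end
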